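(* Let $r\geq 2$ and $n\geq 1$ be integers, and let $K_n^r$ be the $r$-complete hypergraph of order $n$. Let $a_1(K_n^r)$ be the coefficient of $\lambda$ in the chromatic polynomial of $K_n^r$. Then $$a_1(K_n^r)=-(n-1)!\,\mu_{r-1}(n),$$ where, for an integer $m\geq 1$, $$\mu_m(n)=\sum_{i=1}^{m}R_i^{-n}$$ and $R_1,\dots,R_m$ denote the (complex) roots of the $m$-th Taylor polynomial $E_m(x)=\sum_{k=0}^{m}\frac{x^k}{k!}$ of the exponential function.
   Context: The $r$-complete hypergraph $K_n^r$ of order $n$ has vertex set $V=\{1,2,\dots,n\}$ and its edge set consists of all subsets of $V$ of cardinality $r$ (so there are no edges if $n<r$). For a hypergraph $H=(V,E)$ (with $V$ finite non-empty and $E$ a set of subsets of $V$ of cardinality at least $2$) and $\lambda\in\mathbb{N}$, a proper $\lambda$-colouring is a map $\pi:V\to\{1,\dots,\lambda\}$ such that each edge contains two vertices $x,y$ with $\pi(x)\neq\pi(y)$. The number $\chi_H(\lambda)$ of proper $\lambda$-colourings is a polynomial in $\lambda$, the chromatic polynomial of $H$, given by $\chi_H(\lambda)=\sum_{F\subseteq E}(-1)^{|F|}\lambda^{k(F)}$, where $k(F)$ is the number of connected components of $(V,F)$ (isolated vertices count as components). Thus $a_1(H)=\sum_{F\subseteq E,\,k(F)=1}(-1)^{|F|}$. *)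

theory Defs
  imports
    "HOL-Library.FuncSet"
    "HOL-Computational_Algebra.Computational_Algebra"
    Complex_Main
begin

type_synonym 'a hypergraph = "'a set \<times> 'a set set"

definition hypergraph :: "'a hypergraph \<Rightarrow> bool" where
  "hypergraph = (\<lambda>(V, E). finite V \<and> V \<noteq> {} \<and> (\<forall>e\<in>E. e \<subseteq> V \<and> 2 \<le> card e))"

definition proper_colourings :: "'a hypergraph \<Rightarrow> nat \<Rightarrow> ('a \<Rightarrow> nat) set" where
  "proper_colourings = (\<lambda>(V, E) k.
     {c \<in> V \<rightarrow>\<^sub>E {1..k}. \<forall>e\<in>E. \<exists>x\<in>e. \<exists>y\<in>e. c x \<noteq> c y})"

text \<open>
  The chromatic polynomial is the polynomial whose values count the proper colourings.
  Its existence and uniqueness, and the expansion over sets of edges, are proved at the end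
  of this theory.
\<close>

definition chromatic_poly :: "'a hypergraph \<Rightarrow> int poly" where
  "chromatic_poly H = (THE p. \<forall>k. poly p (int k) = int (card (proper_colourings H k)))"

definition complete_hypergraph :: "nat \<Rightarrow> nat \<Rightarrow> nat hypergraph" where
  "complete_hypergraph r n = ({1..n}, {e. e \<subseteq> {1..n} \<and> card e = r})"

definition exp_taylor_poly :: "nat \<Rightarrow> complex poly" where
  "exp_taylor_poly m = (\<Sum>k\<le>m. monom (1 / fact k) k)"

text \<open>The roots are taken with multiplicity, so that there are exactly \<open>m\<close> of them.\<close>

definition mu :: "nat \<Rightarrow> nat \<Rightarrow> complex" where
  "mu m n = (\<Sum>R\<in>#proots (exp_taylor_poly m). R powi (- int n))"

lemma hypergraph_complete_hypergraph:
  assumes "2 \<le> r" "1 \<le> n"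
  shows "hypergraph (complete_hypergraph r n)"
  using assms by (auto simp: hypergraph_def complete_hypergraph_def)

lemma poly_exp_taylor_poly: "poly (exp_taylor_poly m) x = (\<Sum>k\<le>m. x ^ k / fact k)"
  by (simp add: exp_taylor_poly_def poly_sum poly_monom)

lemma degree_exp_taylor_poly: "degree (exp_taylor_poly m) = m"
proof (rule antisym)
  show "degree (exp_taylor_poly m) \<le> m"
    unfolding exp_taylor_poly_def
    by (intro degree_sum_le) (auto intro: order.trans[OF degree_monom_le])
  have "coeff (exp_taylor_poly m) m = 1 / fact m"
    by (simp add: exp_taylor_poly_def coeff_sum)
  then show "m \<le> degree (exp_taylor_poly m)"
    by (intro le_degree) simp
qed

lemma size_proots_exp_taylor_poly: "size (proots (exp_taylor_poly m)) = m"
  by (simp add: size_proots_complex degree_exp_taylor_poly)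

definition connected_rel :: "'a hypergraph \<Rightarrow> ('a \<times> 'a) set" where
  "connected_rel = (\<lambda>(V, F). {(x, y). \<exists>e\<in>F. x \<in> e \<and> y \<in> e}\<^sup>* \<inter> V \<times> V)"

definition num_components :: "'a hypergraph \<Rightarrow> nat" where
  "num_components H = card (fst H // connected_rel H)"

lemma equiv_connected_rel: "equiv V (connected_rel (V, F))"
proof (rule equivI)
  have "sym ({(x, y). \<exists>e\<in>F. x \<in> e \<and> y \<in> e}\<^sup>*)"
    by (rule sym_rtrancl) (auto simp: sym_def)
  then show "sym (connected_rel (V, F))"
    by (auto simp: connected_rel_def sym_def)
  show "trans (connected_rel (V, F))"
    by (auto simp: connected_rel_def trans_def)
qed (auto simp: connected_rel_def refl_on_def)

lemma card_constant_colourings: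
  assumes fin: "finite V" and sub: "\<And>e. e \<in> F \<Longrightarrow> e \<subseteq> V"
  shows "card {c \<in> V \<rightarrow>\<^sub>E {1..k::nat}. \<forall>e\<in>F. \<forall>x\<in>e. \<forall>y\<in>e. c x = c y}
           = k ^ num_components (V, F)" (is "card ?A = _")
proof -
  let ?R = "connected_rel (V, F)"
  note eq = equiv_connected_rel[of V F]
  define up where "up = (\<lambda>d x. if x \<in> V then d (?R `` {x}) else undefined :: nat)"
  have const: "c x = c y" if "c \<in> ?A" "(x, y) \<in> ?R" for c x y
  proof -
    have "(x, y) \<in> {(x, y). \<exists>e\<in>F. x \<in> e \<and> y \<in> e}\<^sup>*"
      using that by (auto simp: connected_rel_def)
    then show ?thesis
      by induction (use that(1) in auto)
  qed
  have edge: "(x, y) \<in> ?R" if "e \<in> F" "x \<in> e" "y \<in> e" for e x y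
    using that sub by (auto simp: connected_rel_def)
  have "bij_betw up ((V // ?R) \<rightarrow>\<^sub>E {1..k}) ?A"
  proof (rule bij_betw_imageI)
    show "inj_on up ((V // ?R) \<rightarrow>\<^sub>E {1..k})"
    proof (rule inj_onI)
      fix d d' assume d: "d \<in> (V // ?R) \<rightarrow>\<^sub>E {1..k}" "d' \<in> (V // ?R) \<rightarrow>\<^sub>E {1..k}"
        and e: "up d = up d'"
      show "d = d'"
      proof (rule PiE_ext[OF d])
        fix X assume "X \<in> V // ?R"
        then obtain x where "x \<in> V" "X = ?R `` {x}" by (auto elim: quotientE)
        then show "d X = d' X" using fun_cong[OF e, of x] by (simp add: up_def)
      qed
    qed
    show "up ` ((V // ?R) \<rightarrow>\<^sub>E {1..k}) = ?A"
    proof (intro equalityI subsetI)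
      fix c assume "c \<in> up ` ((V // ?R) \<rightarrow>\<^sub>E {1..k})"
      then obtain d where d: "d \<in> (V // ?R) \<rightarrow>\<^sub>E {1..k}" and c: "c = up d" by auto
      have "c \<in> V \<rightarrow>\<^sub>E {1..k}"
      proof (rule PiE_I)
        fix x assume "x \<in> V"
        then show "c x \<in> {1..k}"
          using PiE_mem[OF d quotientI] by (simp add: c up_def)
      qed (simp add: c up_def)
      moreover have "c x = c y" if "e \<in> F" "x \<in> e" "y \<in> e" for e x y
        using equiv_class_eq[OF eq edge[OF that]] that sub by (auto simp: c up_def)
      ultimately show "c \<in> ?A" by blast
    next
      fix c assume c: "c \<in> ?A"
      then have cV: "c \<in> V \<rightarrow>\<^sub>E {1..k}" by blast
      define d where "d = (\<lambda>X\<in>V // ?R. c (SOME x. x \<in> X))"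
      have key: "d (?R `` {x}) = c x" if "x \<in> V" for x
      proof -
        have "x \<in> ?R `` {x}" using eq that by (rule equiv_class_self)
        then have "(SOME y. y \<in> ?R `` {x}) \<in> ?R `` {x}" by (rule someI)
        then have "c x = c (SOME y. y \<in> ?R `` {x})" by (intro const[OF c]) simp
        then show ?thesis using that by (simp add: d_def quotientI)
      qed
      have "d \<in> (V // ?R) \<rightarrow>\<^sub>E {1..k}"
      proof (rule PiE_I)
        fix X assume "X \<in> V // ?R"
        then obtain x where "x \<in> V" "X = ?R `` {x}" by (auto elim: quotientE)
        then show "d X \<in> {1..k}" using key PiE_mem[OF cV] by metis
      qed (simp add: d_def)
      moreover have "c = up d"
      proof (rule ext)
        fix x show "c x = up d x"
          using PiE_arb[OF cV, of x] key[of x] by (cases "x \<in> V") (simp_all add: up_def)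
      qed
      ultimately show "c \<in> up ` ((V // ?R) \<rightarrow>\<^sub>E {1..k})" by blast
    qed
  qed
  then have "card ?A = card ((V // ?R) \<rightarrow>\<^sub>E {1..k})"
    by (simp add: bij_betw_same_card)
  also have "\<dots> = k ^ card (V // ?R)"
    using fin by (simp add: card_PiE finite_quotient connected_rel_def)
  finally show ?thesis by (simp add: num_components_def)
qed

lemma sum_Pow_alternating:
  assumes "finite A"
  shows "(\<Sum>F\<in>Pow A. (- 1) ^ card F) = (if A = {} then 1 else 0 :: int)"
  using assms
proof (induction A)
  case (insert a A)
  have inj: "inj_on (insert a) (Pow A)"
    using insert.hyps by (auto simp: inj_on_def)
  have "(\<Sum>F\<in>Pow (insert a A). (- 1) ^ card F)
          = (\<Sum>F\<in>Pow A. (- 1) ^ card F) + (\<Sum>F\<in>insert a ` Pow A. (- 1 :: int) ^ card F)"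
    unfolding Pow_insert using insert.hyps by (intro sum.union_disjoint) auto
  also have "(\<Sum>F\<in>insert a ` Pow A. (- 1 :: int) ^ card F)
               = (\<Sum>F\<in>Pow A. (- 1) ^ card (insert a F))"
    by (simp add: sum.reindex[OF inj])
  also have "\<dots> = (\<Sum>F\<in>Pow A. - ((- 1) ^ card F))"
  proof (rule sum.cong[OF refl])
    fix F assume "F \<in> Pow A"
    then have "finite F" "a \<notin> F" using insert.hyps by (auto intro: finite_subset)
    then show "(- 1 :: int) ^ card (insert a F) = - ((- 1) ^ card F)" by simp
  qed
  finally show ?case by (simp add: sum_negf)
qed simp

lemma card_proper_colourings:
  fixes V :: "'a set"
  assumes "hypergraph (V, E)"
  shows "int (card (proper_colourings (V, E) k))
           = (\<Sum>F\<in>Pow E. (- 1) ^ card F * int k ^ num_components (V, F))"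
proof -
  have fin: "finite V" and sub: "\<And>e. e \<in> E \<Longrightarrow> e \<subseteq> V"
    using assms by (auto simp: hypergraph_def)
  have finE: "finite E"
    using fin sub by (intro finite_subset[of E "Pow V"]) auto
  let ?C = "V \<rightarrow>\<^sub>E {1..k}"
  define mono_on_edge where "mono_on_edge = (\<lambda>(c :: 'a \<Rightarrow> nat) e. \<forall>x\<in>e. \<forall>y\<in>e. c x = c y)"
  have finC: "finite ?C" using fin by (simp add: finite_PiE)
  have "int (card (proper_colourings (V, E) k)) = (\<Sum>c\<in>?C. if {e\<in>E. mono_on_edge c e} = {} then 1 else 0)"
  proof -
    have "proper_colourings (V, E) k = {c \<in> ?C. {e\<in>E. mono_on_edge c e} = {}}"
      by (auto simp: proper_colourings_def mono_on_edge_def)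
    then show ?thesis using finC by (simp add: sum.If_cases Int_def)
  qed
  also have "\<dots> = (\<Sum>c\<in>?C. \<Sum>F\<in>Pow {e\<in>E. mono_on_edge c e}. (- 1) ^ card F)"
    using finE by (intro sum.cong refl sum_Pow_alternating[symmetric]) simp
  also have "\<dots> = (\<Sum>c\<in>?C. \<Sum>F\<in>Pow E. if \<forall>e\<in>F. mono_on_edge c e then (- 1) ^ card F else 0)"
  proof (rule sum.cong[OF refl])
    fix c
    show "(\<Sum>F\<in>Pow {e\<in>E. mono_on_edge c e}. (- 1) ^ card F)
        = (\<Sum>F\<in>Pow E. if \<forall>e\<in>F. mono_on_edge c e then (- 1) ^ card F else 0 :: int)"
      by (rule sum.mono_neutral_cong_left) (use finE in auto)
  qed
  also have "\<dots> = (\<Sum>F\<in>Pow E. \<Sum>c\<in>?C. if \<forall>e\<in>F. mono_on_edge c e then (- 1) ^ card F else 0)"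
    by (rule sum.swap)
  also have "\<dots> = (\<Sum>F\<in>Pow E. (- 1) ^ card F * int k ^ num_components (V, F))"
  proof (rule sum.cong[OF refl])
    fix F assume "F \<in> Pow E"
    then have "card {c \<in> ?C. \<forall>e\<in>F. mono_on_edge c e} = k ^ num_components (V, F)"
      unfolding mono_on_edge_def using fin sub by (intro card_constant_colourings) auto
    moreover have "(\<Sum>c\<in>?C. if \<forall>e\<in>F. mono_on_edge c e then (- 1) ^ card F else 0)
        = (- 1) ^ card F * int (card {c \<in> ?C. \<forall>e\<in>F. mono_on_edge c e})"
      using finC by (simp add: sum.If_cases Int_def)
    ultimately show "(\<Sum>c\<in>?C. if \<forall>e\<in>F. mono_on_edge c e then (- 1) ^ card F else 0)
        = (- 1) ^ card F * int k ^ num_components (V, F)" by simp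
  qed
  finally show ?thesis .
qed

lemma counting_poly_unique:
  fixes p q :: "int poly"
  assumes "\<And>k. poly p (int k) = poly q (int k)"
  shows "p = q"
proof (rule ccontr)
  assume "p \<noteq> q"
  then have "finite {x. poly (p - q) x = 0}" by (intro poly_roots_finite) simp
  moreover have "range int \<subseteq> {x. poly (p - q) x = 0}" using assms by auto
  ultimately have "finite (range int)" by (rule rev_finite_subset)
  then show False by (simp add: finite_image_iff)
qed

lemma chromatic_poly_eqI:
  assumes "\<And>k. poly p (int k) = int (card (proper_colourings H k))"
  shows "chromatic_poly H = p"
  unfolding chromatic_poly_def
  by (rule the_equality) (use assms in \<open>auto intro: counting_poly_unique\<close>)

theorem chromatic_poly_expansion:
  assumes "hypergraph (V, E)"
  shows "chromatic_poly (V, E) = (\<Sum>F\<in>Pow E. monom ((- 1) ^ card F) (num_components (V, F)))"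
  by (rule chromatic_poly_eqI)
     (simp add: card_proper_colourings[OF assms] poly_sum poly_monom)

corollary poly_chromatic_poly:
  assumes "hypergraph (V, E)"
  shows "poly (chromatic_poly (V, E)) (int k) = int (card (proper_colourings (V, E) k))"
  by (simp add: chromatic_poly_expansion[OF assms] card_proper_colourings[OF assms]
      poly_sum poly_monom)

end

theory Submission
  imports Defs
begin

text \<open>
  A colouring of \<open>K\<^sub>n\<^sup>r\<close> is proper iff every colour class has at most \<open>r - 1\<close>
  elements, so the number of proper \<open>k\<close>-colourings is \<open>n!\<close> times the coefficient of
  \<open>x\<^sup>n\<close> in \<open>E\<^sup>k\<close>, where \<open>E\<close> is the Taylor polynomial of degree \<open>r - 1\<close>. With \<open>L = E' / E\<close> the
  identity \<open>(E\<^sup>k)' = k L E\<^sup>k\<close> is a recursion showing that these coefficients are polynomials in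
  \<open>k\<close> with linear coefficient \<open>L\<^bsub>n-1\<^esub> / n\<close>. Finally \<open>L = \<Sum>\<^sub>R 1 / (x - R)\<close>, summed over the
  roots \<open>R\<close> of \<open>E\<close>, so that \<open>L\<^bsub>n-1\<^esub> = - \<Sum>\<^sub>R R\<^bsup>-n\<^esup>\<close>.
\<close>

section \<open>Colourings with bounded colour classes\<close>

definition bounded_colourings :: "nat \<Rightarrow> 'a set \<Rightarrow> nat \<Rightarrow> ('a \<Rightarrow> nat) set" where
  "bounded_colourings m V k = {c \<in> V \<rightarrow>\<^sub>E {1..k}. \<forall>i. card {x\<in>V. c x = i} \<le> m}"

lemma finite_bounded_colourings: "finite V \<Longrightarrow> finite (bounded_colourings m V k)"
  unfolding bounded_colourings_def
  by (rule finite_subset[of _ "V \<rightarrow>\<^sub>E {1..k}"]) (auto intro: finite_PiE)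

text \<open>A monochromatic edge is an \<open>r\<close>-subset of a single colour class, and a class
  contains such a subset iff it has at least \<open>r\<close> elements. The bound on
  \<open>r\<close> makes edges nonempty, so that a monochromatic edge has a definite colour.\<close>

lemma proper_colourings_complete_hypergraph:
  assumes "2 \<le> r"
  shows "proper_colourings (complete_hypergraph r n) k = bounded_colourings (r - 1) {1..n} k"
proof -
  have "(\<forall>e. e \<subseteq> {1..n} \<and> card e = r \<longrightarrow> (\<exists>x\<in>e. \<exists>y\<in>e. c x \<noteq> c y))
          \<longleftrightarrow> (\<forall>i. card {x\<in>{1..n}. c x = i} \<le> r - 1)" (is "?L \<longleftrightarrow> ?R") for c :: "nat \<Rightarrow> nat"
  proof
    assume L: ?L
    show ?R
    proof (rule allI, rule ccontr)
      fix i assume "\<not> card {x\<in>{1..n}. c x = i} \<le> r - 1"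
      then have "r \<le> card {x\<in>{1..n}. c x = i}" by simp
      then obtain e where "e \<subseteq> {x\<in>{1..n}. c x = i}" "card e = r"
        by (meson obtain_subset_with_card_n)
      with L show False by blast
    qed
  next
    assume R: ?R
    show ?L
    proof (intro allI impI, rule ccontr)
      fix e assume e: "e \<subseteq> {1..n} \<and> card e = r" and "\<not> (\<exists>x\<in>e. \<exists>y\<in>e. c x \<noteq> c y)"
      then have mono: "c x = c y" if "x \<in> e" "y \<in> e" for x y using that by blast
      from e assms obtain z where z: "z \<in> e" by fastforce
      have "e \<subseteq> {x\<in>{1..n}. c x = c z}" using e z mono by blast
      then have "card e \<le> card {x\<in>{1..n}. c x = c z}" by (intro card_mono) auto
      also have "\<dots> \<le> r - 1" using R by blast
      finally show False using e assms by simp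
    qed
  qed
  then show ?thesis
    unfolding proper_colourings_def complete_hypergraph_def bounded_colourings_def by auto
qed

text \<open>Deleting the class \<open>S\<close> of the last colour \<open>Suc k\<close> is undone by
  painting \<open>S\<close> with \<open>Suc k\<close> again; \<open>card S \<le> m\<close> keeps the
  repainted colouring bounded.\<close>

lemma card_bounded_colourings_fibre:
  assumes "finite V" "S \<subseteq> V" "card S \<le> m"
  shows "card {c \<in> bounded_colourings m V (Suc k). {x\<in>V. c x = Suc k} = S}
           = card (bounded_colourings m (V - S) k)"
proof (rule bij_betw_same_card)
  define ext where "ext = (\<lambda>d x. if x \<in> S then Suc k else d x :: nat)"
  show "bij_betw (\<lambda>c. restrict c (V - S))
          {c \<in> bounded_colourings m V (Suc k). {x\<in>V. c x = Suc k} = S}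
          (bounded_colourings m (V - S) k)" (is "bij_betw _ ?A ?B")
  proof (rule bij_betw_byWitness[where f' = ext])
    show "\<forall>c\<in>?A. ext (restrict c (V - S)) = c"
    proof (intro ballI ext)
      fix c x assume c: "c \<in> ?A"
      then show "ext (restrict c (V - S)) x = c x"
        using assms(2) by (auto simp: ext_def bounded_colourings_def restrict_def PiE_def extensional_def)
    qed
    show "\<forall>d\<in>?B. restrict (ext d) (V - S) = d"
    proof (intro ballI ext)
      fix d x assume "d \<in> ?B"
      then show "restrict (ext d) (V - S) x = d x"
        by (auto simp: ext_def bounded_colourings_def restrict_def PiE_def extensional_def)
    qed
    show "(\<lambda>c. restrict c (V - S)) ` ?A \<subseteq> ?B"
    proof (rule image_subsetI)
      fix c assume c: "c \<in> ?A"
      have "card {x \<in> V - S. restrict c (V - S) x = i} \<le> m" for i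
      proof -
        have "card {x \<in> V - S. restrict c (V - S) x = i} \<le> card {x\<in>V. c x = i}"
          using assms(1) by (intro card_mono) auto
        with c show ?thesis unfolding bounded_colourings_def using le_trans by blast
      qed
      moreover have "restrict c (V - S) \<in> (V - S) \<rightarrow>\<^sub>E {1..k}"
      proof (rule restrict_PiE_iff[THEN iffD2], rule ballI)
        fix x assume x: "x \<in> V - S"
        with c have "c x \<in> {1..Suc k}" "c x \<noteq> Suc k"
          by (auto simp: bounded_colourings_def)
        then show "c x \<in> {1..k}" by auto
      qed
      ultimately show "restrict c (V - S) \<in> ?B" by (simp add: bounded_colourings_def)
    qed
    show "ext ` ?B \<subseteq> ?A"
    proof (rule image_subsetI)
      fix d assume d: "d \<in> ?B"
      then have dV: "d \<in> (V - S) \<rightarrow>\<^sub>E {1..k}" and dm: "\<And>i. card {x \<in> V - S. d x = i} \<le> m"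
        by (auto simp: bounded_colourings_def)
      have range: "d x \<in> {1..k}" if "x \<in> V - S" for x using dV that by blast
      \<comment> \<open>The values of \<open>d\<close> on \<open>V - S\<close> are at most
        \<open>k\<close>, so the colour \<open>Suc k\<close> is fresh.\<close>
      have top: "{x\<in>V. ext d x = Suc k} = S"
        using assms(2) range by (force simp: ext_def)
      have "card {x\<in>V. ext d x = i} \<le> m" for i
      proof (cases "i = Suc k")
        case False
        then have "{x\<in>V. ext d x = i} = {x \<in> V - S. d x = i}" by (auto simp: ext_def)
        then show ?thesis using dm by simp
      qed (use top assms(3) in simp)
      moreover have "ext d \<in> V \<rightarrow>\<^sub>E {1..Suc k}"
      proof (rule PiE_I)
        fix x assume "x \<in> V"
        then show "ext d x \<in> {1..Suc k}" using range[of x] by (auto simp: ext_def)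
      next
        fix x assume "x \<notin> V"
        then show "ext d x = undefined"
          using assms(2) PiE_arb[OF dV, of x] by (auto simp: ext_def)
      qed
      ultimately show "ext d \<in> ?A" using top by (simp add: bounded_colourings_def)
    qed
  qed
qed

section \<open>Exponential generating function of the colourings\<close>

lemma fps_nth_exp_taylor_poly:
  "fps_of_poly (exp_taylor_poly m) $ j = (if j \<le> m then 1 / fact j else 0)"
  by (simp add: exp_taylor_poly_def coeff_sum)

text \<open>Adding a colour multiplies the exponential generating function by that of a single class
  of size at most \<open>m\<close>, which is the Taylor polynomial. \<open>V\<close> stays arbitrary
  in the induction because removing the new class leaves \<open>V - S\<close>.\<close>

lemma card_bounded_colourings:
  assumes "finite V"
  shows "of_nat (card (bounded_colourings m V k))
           = fact (card V) * (fps_of_poly (exp_taylor_poly m) ^ k) $ card V"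
  using assms
proof (induction k arbitrary: V)
  case 0
  then show ?case
    by (cases "V = {}") (auto simp: bounded_colourings_def card_gt_0_iff PiE_eq_empty_iff)
next
  case (Suc k)
  let ?E = "fps_of_poly (exp_taylor_poly m)"
  let ?n = "card V"
  let ?S = "{S \<in> Pow V. card S \<le> m}"
  have fS: "finite ?S" using Suc.prems by simp
  have "bounded_colourings m V (Suc k)
          = (\<Union>S\<in>?S. {c \<in> bounded_colourings m V (Suc k). {x\<in>V. c x = Suc k} = S})"
    by (auto simp: bounded_colourings_def)
  then have "card (bounded_colourings m V (Suc k))
          = card (\<Union>S\<in>?S. {c \<in> bounded_colourings m V (Suc k). {x\<in>V. c x = Suc k} = S})"
    by simp
  also have "\<dots> = (\<Sum>S\<in>?S. card {c \<in> bounded_colourings m V (Suc k). {x\<in>V. c x = Suc k} = S})"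
    by (rule card_UN_disjoint[OF fS])
       (use finite_bounded_colourings[OF Suc.prems] in auto)
  also have "\<dots> = (\<Sum>S\<in>?S. card (bounded_colourings m (V - S) k))"
    by (intro sum.cong refl card_bounded_colourings_fibre[OF Suc.prems]) auto
  finally have "complex_of_nat (card (bounded_colourings m V (Suc k)))
          = (\<Sum>S\<in>?S. of_nat (card (bounded_colourings m (V - S) k)))" by simp
  also have "\<dots> = (\<Sum>S\<in>?S. fact (?n - card S) * (?E ^ k) $ (?n - card S))"
  proof (rule sum.cong[OF refl])
    fix S assume "S \<in> ?S"
    then have "card (V - S) = ?n - card S"
      using Suc.prems by (intro card_Diff_subset) (auto intro: finite_subset)
    then show "of_nat (card (bounded_colourings m (V - S) k))
                 = fact (?n - card S) * (?E ^ k) $ (?n - card S)"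
      using Suc.IH[of "V - S"] Suc.prems by simp
  qed
  \<comment> \<open>The size bound moves into the summand, which then depends on
    \<open>card S\<close> only; subsets are next grouped by size.\<close>
  also have "\<dots> = (\<Sum>S\<in>Pow V. if card S \<le> m then fact (?n - card S) * (?E ^ k) $ (?n - card S) else 0)"
    using Suc.prems by (intro sum.inter_filter) simp
  also have "\<dots> = (\<Sum>j\<le>?n. \<Sum>S\<in>{S\<in>Pow V. card S = j}.
                  if card S \<le> m then fact (?n - card S) * (?E ^ k) $ (?n - card S) else 0)"
    using Suc.prems by (intro sum.group[symmetric]) (auto intro: card_mono)
  also have "\<dots> = (\<Sum>j\<le>?n. of_nat (?n choose j) *
                  (if j \<le> m then fact (?n - j) * (?E ^ k) $ (?n - j) else 0))"
  proof (rule sum.cong[OF refl])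
    fix j
    have "card {S\<in>Pow V. card S = j} = ?n choose j"
      using n_subsets[OF Suc.prems] by simp
    then show "(\<Sum>S\<in>{S\<in>Pow V. card S = j}.
                  if card S \<le> m then fact (?n - card S) * (?E ^ k) $ (?n - card S) else 0)
        = of_nat (?n choose j) * (if j \<le> m then fact (?n - j) * (?E ^ k) $ (?n - j) else 0)"
      by simp
  qed
  \<comment> \<open>Here \<open>(?n choose j) * fact (?n - j) = fact ?n / fact j\<close>, and
    \<open>?E $ j\<close> vanishes for \<open>j > m\<close> just as the conditional does.\<close>
  also have "\<dots> = (\<Sum>j\<le>?n. fact ?n * (?E $ j * (?E ^ k) $ (?n - j)))"
    by (intro sum.cong refl) (auto simp: fps_nth_exp_taylor_poly binomial_fact simp del: fps_of_poly_nth)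
  also have "\<dots> = fact ?n * (?E ^ Suc k) $ ?n"
    by (simp add: fps_mult_nth sum_distrib_left atLeast0AtMost)
  finally show ?case .
qed

section \<open>Coefficients of powers as polynomials in the exponent\<close>

lemma poly_eqI_of_nat:
  fixes p q :: "'a::{idom, ring_char_0} poly"
  assumes "\<And>k. poly p (of_nat k) = poly q (of_nat k)"
  shows "p = q"
proof (rule ccontr)
  assume "p \<noteq> q"
  then have "finite {x. poly (p - q) x = 0}" by (intro poly_roots_finite) simp
  moreover have "range of_nat \<subseteq> {x. poly (p - q) x = 0}" using assms by auto
  ultimately have "finite (range (of_nat :: nat \<Rightarrow> 'a))" by (rule rev_finite_subset)
  then show False by (simp add: finite_image_iff inj_of_nat)
qed

lemma poly_map_poly_of_int:
  "poly (map_poly of_int p) (of_int x :: 'a::comm_ring_1) = of_int (poly p x)"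
  by (induction p) (simp_all add: map_poly_pCons)

text \<open>Strong induction on \<open>n\<close>, comparing coefficients of index
  \<open>n - 1\<close> in the differential equation for \<open>A ^ k\<close>. The constant
  coefficient is carried along because the factor \<open>k\<close> in the recursion turns it into
  the next linear coefficient.\<close>

lemma fps_nth_power_eq_poly:
  fixes A L :: "'a::field_char_0 fps"
  assumes A0: "A $ 0 = 1" and L: "fps_deriv A = A * L"
  shows "\<exists>q. (\<forall>k. poly q (of_nat k) = (A ^ k) $ n) \<and> coeff q 0 = (if n = 0 then 1 else 0) \<and>
             coeff q 1 = (if n = 0 then 0 else L $ (n - 1) / of_nat n)"
proof (induction n rule: less_induct)
  case (less n)
  show ?case
  proof (cases n)
    case 0
    then show ?thesis by (intro exI[of _ 1]) (simp add: A0 fps_nth_power_0)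
  next
    case (Suc m)
    have "\<forall>i\<in>{..m}. \<exists>q. (\<forall>k. poly q (of_nat k) = (A ^ k) $ i) \<and> coeff q 0 = (if i = 0 then 1 else 0)"
      using less.IH Suc by (metis atMost_iff le_imp_less_Suc)
    then obtain Q where Q: "\<And>i k. i \<le> m \<Longrightarrow> poly (Q i) (of_nat k) = (A ^ k) $ i"
      and Q0: "\<And>i. i \<le> m \<Longrightarrow> coeff (Q i) 0 = (if i = 0 then 1 else 0)"
      by (metis atMost_iff)
    \<comment> \<open>This is the recursion solved for the coefficient of index
      \<open>Suc m\<close>; \<open>pCons 0\<close> supplies the factor \<open>k\<close>.\<close>
    define q where "q = smult (1 / of_nat (Suc m)) (pCons 0 (\<Sum>i\<le>m. smult (L $ (m - i)) (Q i)))"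
    have "poly q (of_nat k) = (A ^ k) $ n" for k
    proof -
      have "fps_deriv (A ^ k) = of_nat k * fps_deriv A * A ^ (k - 1)"
        by (rule fps_deriv_power')
      also have "\<dots> = of_nat k * (A ^ k * L)"
        \<comment> \<open>For \<open>k = 0\<close>, where \<open>k - 1\<close> truncates, both sides
          vanish through the factor \<open>of_nat k\<close>.\<close>
        unfolding L by (cases k) (simp_all add: mult_ac)
      finally have "of_nat (Suc m) * (A ^ k) $ Suc m = of_nat k * (A ^ k * L) $ m"
        using fps_deriv_nth[of "A ^ k" m] by (metis Suc_eq_plus1 fps_mult_of_nat_nth(1))
      also have "(A ^ k * L) $ m = (\<Sum>i\<le>m. L $ (m - i) * poly (Q i) (of_nat k))"
        unfolding fps_mult_nth atLeast0AtMost using Q by (simp add: mult.commute)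
      also have "of_nat k * \<dots> = of_nat (Suc m) * poly q (of_nat k)"
        by (simp add: q_def poly_sum del: of_nat_Suc)
      finally show ?thesis using Suc by (simp del: of_nat_Suc)
    qed
    moreover have "coeff q 1 = L $ m / of_nat n"
    proof -
      \<comment> \<open>Only \<open>Q 0\<close> has a nonzero constant coefficient, so a single term
        survives.\<close>
      have "(\<Sum>i\<le>m. L $ (m - i) * coeff (Q i) 0) = (\<Sum>i\<le>m. if i = 0 then L $ m else 0)"
        by (rule sum.cong) (simp_all add: Q0)
      then show ?thesis using Suc by (simp add: q_def coeff_sum del: of_nat_Suc)
    qed
    moreover have "coeff q 0 = 0" by (simp add: q_def)
    ultimately show ?thesis using Suc by (intro exI[of _ q]) simp
  qed
qed

section \<open>Logarithmic derivative and power sums of the roots\<close>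

text \<open>Logarithmic derivatives add over factors, and for \<open>R \<noteq> 0\<close> the
  geometric series expands \<open>1 / (x - R)\<close> with coefficients
  \<open>- R powi (- int (Suc n))\<close>. A multiset accounts for repeated roots.\<close>

lemma fps_deriv_prod_linear_factors:
  fixes M :: "complex multiset"
  assumes "0 \<notin># M"
  shows "fps_deriv (fps_of_poly (\<Prod>R\<in>#M. [:-R, 1:]))
           = fps_of_poly (\<Prod>R\<in>#M. [:-R, 1:]) * Abs_fps (\<lambda>n. - (\<Sum>R\<in>#M. R powi (- int (Suc n))))"
  using assms
proof (induction M)
  case empty
  then show ?case by (simp add: fps_zero_def[symmetric])
next
  case (add R M)
  let ?g = "fps_of_poly (\<Prod>R\<in>#M. [:-R, 1:])"
  let ?l = "fps_of_poly [:-R, 1:]"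
  let ?G = "Abs_fps (\<lambda>n. - (R powi (- int (Suc n))))"
  have R: "R \<noteq> 0" using add.prems by auto
  have l: "?l = fps_X - fps_const R"
    by (simp add: fps_of_poly_pCons)
  have G: "?G = Abs_fps (\<lambda>n. - (inverse R ^ Suc n))"
    by (simp only: power_int_minus power_int_of_nat power_inverse)
  have inv: "?l * ?G = 1"
  proof (rule fps_ext)
    fix n show "(?l * ?G) $ n = 1 $ n"
      unfolding l G using R by (cases n) (simp_all add: algebra_simps)
  qed
  have split: "Abs_fps (\<lambda>n. - (\<Sum>R\<in>#add_mset R M. R powi (- int (Suc n))))
                 = ?G + Abs_fps (\<lambda>n. - (\<Sum>R\<in>#M. R powi (- int (Suc n))))"
    by (rule fps_ext) simp
  have "fps_deriv (?l * ?g) = ?g + ?l * fps_deriv ?g"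
    by (simp add: l)
  \<comment> \<open>Inserting \<open>?l * ?G = 1\<close> gives both summands the common factor
    \<open>?l\<close>.\<close>
  also have "\<dots> = (?l * ?G) * ?g + ?l * fps_deriv ?g" unfolding inv by simp
  also have "\<dots> = ?l * ?g * (?G + Abs_fps (\<lambda>n. - (\<Sum>R\<in>#M. R powi (- int (Suc n)))))"
    using add by (simp add: algebra_simps)
  finally show ?case unfolding split
    by (simp only: image_mset_add_mset prod_mset.add_mset fps_of_poly_mult)
qed

text \<open>The constant term 1 excludes the root 0, and the leading coefficient is a constant
  factor on both sides. The coefficient of index \<open>n\<close> involves the power sum of index
  \<open>Suc n\<close>.\<close>

lemma fps_deriv_exp_taylor_poly:
  "fps_deriv (fps_of_poly (exp_taylor_poly m))
     = fps_of_poly (exp_taylor_poly m) * Abs_fps (\<lambda>n. - mu m (Suc n))"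
proof -
  let ?p = "exp_taylor_poly m"
  have p0: "poly ?p 0 = 1"
    using fps_nth_exp_taylor_poly[of m 0] by (simp add: poly_0_coeff_0)
  then have nz: "?p \<noteq> 0" by auto
  have "0 \<notin># proots ?p" using p0 nz by (simp add: set_count_proots)
  note deriv = fps_deriv_prod_linear_factors[OF this]
  let ?c = "fps_const (lead_coeff ?p)"
  let ?g = "fps_of_poly (\<Prod>R\<in>#proots ?p. [:-R, 1:])"
  let ?L = "Abs_fps (\<lambda>n. - (\<Sum>R\<in>#proots ?p. R powi (- int (Suc n))))"
  have p: "fps_of_poly ?p = ?c * ?g"
    by (metis complex_poly_decompose_multiset fps_of_poly_smult)
  have "fps_deriv (fps_of_poly ?p) = ?c * fps_deriv ?g"
    by (simp only: p fps_deriv_mult_const_left)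
  also have "\<dots> = fps_of_poly ?p * ?L" by (simp only: deriv p mult.assoc)
  finally show ?thesis by (simp only: mu_def)
qed

theorem theorem4p1:
  fixes r n :: nat
  assumes "r \<ge> 2" and "n \<ge> 1"
  shows "complex_of_int (coeff (chromatic_poly (complete_hypergraph r n)) 1)
           = - (fact (n - 1) * mu (r - 1) n)"
proof -
  let ?p = "chromatic_poly (complete_hypergraph r n)"
  let ?E = "fps_of_poly (exp_taylor_poly (r - 1))"
  have E0: "?E $ 0 = 1" unfolding fps_nth_exp_taylor_poly by simp
  obtain q where q: "\<And>k. poly q (of_nat k) = (?E ^ k) $ n" and q1: "coeff q 1 = - mu (r - 1) n / of_nat n"
    using fps_nth_power_eq_poly[OF E0 fps_deriv_exp_taylor_poly, of n] assms(2) by auto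
  \<comment> \<open>The integer chromatic polynomial is moved to the complex numbers, where it
    agrees with \<open>smult (fact n) q\<close> at every natural number.\<close>
  define P where "P = map_poly complex_of_int ?p"
  have "poly P (of_nat k) = poly (smult (fact n) q) (of_nat k)" for k
  proof -
    have "poly P (of_nat k) = of_int (poly ?p (int k))"
      using poly_map_poly_of_int[where x = "int k"] by (simp add: P_def)
    also have "\<dots> = of_nat (card (bounded_colourings (r - 1) {1..n} k))"
      using poly_chromatic_poly[of "{1..n}"] hypergraph_complete_hypergraph[OF assms]
        proper_colourings_complete_hypergraph[OF assms(1)]
      by (simp add: complete_hypergraph_def)
    also have "\<dots> = poly (smult (fact n) q) (of_nat k)"
      by (simp add: card_bounded_colourings q)
    finally show ?thesis .
  qed
  then have "P = smult (fact n) q"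
    by (rule poly_eqI_of_nat)
  then have "coeff P 1 = - (fact n / of_nat n * mu (r - 1) n)" using q1 by simp
  also have "fact n / of_nat n = (fact (n - 1) :: complex)"
    using assms(2) by (cases n) (simp_all del: of_nat_Suc)
  finally show ?thesis by (simp add: P_def coeff_map_poly)
qed

end
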